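(* Let $n\ge 5$, let $H:=\mathfrak{A}_n$ be the alternating group and $G:=\mathfrak{S}_n$ the symmetric group of degree $n$. For nontrivial elements $a,b\in G$, set $A:=a^H$ and $B:=b^H$. For $g\in G$, let $f(g)$ denote the number of fixed points of $g$ in the natural permutation representation of $G$ on $n$ points. Then $f$ is not constant on $AB$.
   Context: For $x\in G$ and a subgroup $H\le G$, $x^H=\{h^{-1}xh\mid h\in H\}$, and $AB=\{xy\mid x\in A,\ y\in B\}$. *)

theory Defs
  imports "HOL-Algebra.Sym_Groups"
begin

definition conj_orbit :: "('a, 'm) monoid_scheme \<Rightarrow> 'a \<Rightarrow> 'a set \<Rightarrow> 'a set"
  where "conj_orbit G x H = {inv\<^bsub>G\<^esub> h \<otimes>\<^bsub>G\<^esub> x \<otimes>\<^bsub>G\<^esub> h | h. h \<in> H}"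

(* Permutations in sym_group n are functions on all of nat which are the identity
   outside {1..n}, so the fixed points have to be counted inside {1..n}. *)
definition num_fixed_points :: "nat \<Rightarrow> (nat \<Rightarrow> nat) \<Rightarrow> nat"
  where "num_fixed_points n g = card {i \<in> {1..n}. g i = i}"

end

theory Submission
  imports Defs
begin

text \<open>
  It is enough to let one factor vary. A fixed point of \<open>h\<inverse> a h b\<close> is, up to applying \<open>b\<close>,
  a point \<open>x\<close> with \<open>h (b\<inverse> x) = a (h x)\<close>. After renaming \<open>b\<inverse>\<close> and \<open>a\<close> to \<open>a\<close> and \<open>b\<close>, the
  question is about two permutations \<open>a\<close>, \<open>b\<close> of a finite set \<open>S\<close>, seen as sets of arcs
  \<open>x \<rightarrow> a x\<close>: how many arcs of \<open>a\<close> does a bijection \<open>h\<close> map to arcs of \<open>b\<close>? This number,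
  \<open>agreements S a b h\<close>, has to be shown to vary with the even permutation \<open>h\<close>.

  Suppose that it is always \<open>c\<close>. Let \<open>n = card S\<close>, and let \<open>p\<close> and \<open>q\<close> be the numbers of fixed
  points of \<open>a\<close> and \<open>b\<close>. The alternating group is doubly transitive, so all pairs of distinct
  points contribute equally to the average over all even \<open>h\<close>, and likewise all loops; this gives
  \<open>(n - 1) c = (n - 1) + (p - 1) (q - 1)\<close> (lemma \<open>constant_agreements_value\<close>). By symmetry let
  \<open>b\<close> move at least as many points as \<open>a\<close>.

  If \<open>q > 0\<close>, choose \<open>h\<close> so that the points moved by \<open>a\<close> go to points moved by \<open>b\<close> and one
  arc of \<open>a\<close> goes to an arc of \<open>b\<close>. All \<open>q\<close> fixed points of \<open>b\<close> then count too, so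
  \<open>c \<ge> q + 1\<close> (lemma \<open>agreements_above_fixed_points\<close>), whereas the formula
  gives \<open>c \<le> q\<close>, because \<open>p \<le> n\<close>.

  If \<open>q = 0\<close>, the formula reads \<open>(n - 1) c = n - p\<close>. The right-hand side lies strictly
  between \<open>0\<close> and \<open>2 (n - 1)\<close>, so \<open>c = 1\<close> and \<open>p = 1\<close>. But then \<open>a\<close> and \<open>b\<close> move almost all
  points, and two arcs can be matched at once (lemma \<open>two_agreements\<close>), so \<open>c \<ge> 2\<close>, a
  contradiction.

  In both cases it is easy to find a suitable \<open>h\<close> in the symmetric group; the work lies in making
  it even, for which there must be a transposition that does not lower the number of matched arcs.
\<close>

section \<open>Arcs common to two permutations\<close>

definition even_perms :: "'a set \<Rightarrow> ('a \<Rightarrow> 'a) set"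
  where "even_perms S = {h. h permutes S \<and> evenperm h}"

definition fixed_points :: "'a set \<Rightarrow> ('a \<Rightarrow> 'a) \<Rightarrow> 'a set"
  where "fixed_points S a = {x \<in> S. a x = x}"

definition agreements :: "'a set \<Rightarrow> ('a \<Rightarrow> 'a) \<Rightarrow> ('a \<Rightarrow> 'a) \<Rightarrow> ('a \<Rightarrow> 'a) \<Rightarrow> nat"
  where "agreements S a b h = card {x \<in> S. h (a x) = b (h x)}"

lemma even_permsD:
  assumes "h \<in> even_perms S"
  shows "h permutes S" and "evenperm h"
  using assms by (auto simp: even_perms_def)

lemma finite_even_perms: "finite S \<Longrightarrow> finite (even_perms S)"
  unfolding even_perms_def by (rule finite_subset[OF _ finite_permutations[of S]]) auto

lemma even_perms_comp:
  assumes "finite S" "g \<in> even_perms S" "h \<in> even_perms S"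
  shows "g \<circ> h \<in> even_perms S"
proof -
  have "permutation g" "permutation h"
    using assms permutes_imp_permutation by (auto simp: even_perms_def)
  then show ?thesis
    using assms by (auto simp: even_perms_def evenperm_comp intro: permutes_compose)
qed

lemma even_perms_inv:
  assumes "finite S" "g \<in> even_perms S"
  shows "inv' g \<in> even_perms S"
proof -
  have "permutation g"
    using assms permutes_imp_permutation by (auto simp: even_perms_def)
  then show ?thesis
    using assms by (auto simp: even_perms_def evenperm_inv intro: permutes_inv)
qed

text \<open>A bijection carries the common arcs of \<open>a\<close> and \<open>b\<close> to those of \<open>b\<close> and \<open>a\<close> when read
  backwards. This makes the roles of the two permutations interchangeable.\<close>

lemma agreements_commute:
  assumes h: "h permutes S"
  shows "agreements S b a (inv' h) = agreements S a b h"
proof -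
  have mem: "h x \<in> S \<longleftrightarrow> x \<in> S" for x
    using permutes_in_image[OF h] .
  have "h ` {x \<in> S. h (a x) = b (h x)} = {y \<in> S. inv' h (b y) = a (inv' h y)}"
  proof (intro equalityI subsetI)
    fix y assume "y \<in> h ` {x \<in> S. h (a x) = b (h x)}"
    then obtain x where x: "y = h x" "x \<in> S" "h (a x) = b (h x)" by blast
    have "inv' h (b y) = a x"
      using x(1) permutes_inverses(2)[OF h, of "a x"] x(3) by simp
    then show "y \<in> {y \<in> S. inv' h (b y) = a (inv' h y)}"
      using x mem permutes_inverses(2)[OF h] by simp
  next
    fix y assume y: "y \<in> {y \<in> S. inv' h (b y) = a (inv' h y)}"
    have "h (inv' h y) = y" using permutes_inverses(1)[OF h] .
    moreover have "h (a (inv' h y)) = b y"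
      using y permutes_inverses(1)[OF h, of "b y"] by simp
    ultimately show "y \<in> h ` {x \<in> S. h (a x) = b (h x)}"
      using y mem[of "inv' h y"] by (intro image_eqI[of _ _ "inv' h y"]) auto
  qed
  then show ?thesis
    unfolding agreements_def
    using card_image[OF permutes_inj_on[OF h], of "{x \<in> S. h (a x) = b (h x)}"] by simp
qed

section \<open>Transitivity of the alternating group\<close>

lemma bij_betw_extends_to_permutation:
  assumes S: "finite S" and A: "A \<subseteq> S" and B: "B \<subseteq> S" and f: "bij_betw f A B"
  obtains h where "h permutes S" "\<And>x. x \<in> A \<Longrightarrow> h x = f x"
proof -
  have "card A = card B" using f by (rule bij_betw_same_card)
  then have "card (S - A) = card (S - B)"
    using S A B by (simp add: card_Diff_subset finite_subset)
  then obtain g where g: "bij_betw g (S - A) (S - B)"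
    using S finite_same_card_bij[of "S - A" "S - B"] by auto
  define h where "h x = (if x \<in> A then f x else if x \<in> S then g x else x)" for x
  have "bij_betw h A B"
    using f by (rule bij_betw_cong[THEN iffD1, rotated]) (simp add: h_def)
  moreover have "bij_betw h (S - A) (S - B)"
    using g by (rule bij_betw_cong[THEN iffD1, rotated]) (simp add: h_def)
  ultimately have "bij_betw h (A \<union> (S - A)) (B \<union> (S - B))"
    by (rule bij_betw_combine) auto
  then have "bij_betw h S S"
    using A B by (simp add: Un_absorb1)
  then have "h permutes S"
    by (rule bij_imp_permutes) (use A in \<open>auto simp: h_def\<close>)
  then show thesis
    by (rule that) (simp add: h_def)
qed

lemma permutation_mapping_lists:
  assumes S: "finite S" and "set xs \<subseteq> S" "set ys \<subseteq> S"
    and "distinct xs" "distinct ys" and len: "length xs = length ys"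
  obtains h where "h permutes S" "map h xs = ys"
proof -
  let ?I = "{..<length xs}"
  have X: "bij_betw ((!) xs) ?I (set xs)" and Y: "bij_betw ((!) ys) ?I (set ys)"
    using assms by (auto intro: bij_betw_nth)
  let ?f = "(!) ys \<circ> inv_into ?I ((!) xs)"
  have "bij_betw ?f (set xs) (set ys)"
    using bij_betw_inv_into[OF X] Y by (rule bij_betw_trans)
  then obtain h where h: "h permutes S" "\<And>x. x \<in> set xs \<Longrightarrow> h x = ?f x"
    using bij_betw_extends_to_permutation[OF S assms(2,3)] by blast
  have "h (xs ! i) = ys ! i" if "i < length xs" for i
    using that h(2)[of "xs ! i"] X by (simp add: bij_betw_def inv_into_f_f)
  then have "map h xs = ys"
    using len by (intro nth_equalityI) auto
  with h(1) show thesis by (rule that)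
qed

lemma even_after_transposition:
  assumes S: "finite S" and h: "h permutes S" "\<not> evenperm h" and ij: "i \<in> S" "j \<in> S" "i \<noteq> j"
  shows "h \<circ> transpose i j \<in> even_perms S" and "transpose i j \<circ> h \<in> even_perms S"
proof -
  have "transpose i j permutes S" using ij by (simp add: permutes_swap_id)
  moreover have "permutation h" using S h permutes_imp_permutation by blast
  ultimately show "h \<circ> transpose i j \<in> even_perms S" and "transpose i j \<circ> h \<in> even_perms S"
    using h ij
    by (auto simp: even_perms_def evenperm_comp evenperm_swap permutation_swap_id
        intro: permutes_compose)
qed

lemma two_distinct_elements:
  assumes "card A \<ge> 2"
  obtains i j where "i \<in> A" "j \<in> A" "i \<noteq> j"
  using assms by (metis card_le_Suc0_iff_eq card.infinite not_less_eq_eq numeral_2_eq_2 zero_le)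

text \<open>The alternating group of degree \<open>n\<close> is \<open>(n - 2)\<close>-transitive: the sign can be corrected by
  exchanging two of the points on which nothing is prescribed.\<close>

lemma even_permutation_mapping_lists:
  assumes S: "finite S" and xs: "set xs \<subseteq> S" "distinct xs" and ys: "set ys \<subseteq> S" "distinct ys"
    and len: "length xs = length ys" and room: "length xs + 2 \<le> card S"
  obtains h where "h \<in> even_perms S" "map h xs = ys"
proof -
  obtain h where h: "h permutes S" "map h xs = ys"
    using permutation_mapping_lists[OF S xs(1) ys(1) xs(2) ys(2) len] .
  show thesis
  proof (cases "evenperm h")
    case True
    with h show thesis by (auto simp: even_perms_def intro: that)
  next
    case False
    have "card (S - set xs) \<ge> 2"
      using room xs S by (simp add: card_Diff_subset distinct_card)
    then obtain i j where ij: "i \<in> S - set xs" "j \<in> S - set xs" "i \<noteq> j"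
      by (rule two_distinct_elements)
    then have "map (h \<circ> transpose i j) xs = map h xs"
      by (auto simp: transpose_def)
    then show thesis
      using that[of "h \<circ> transpose i j"] even_after_transposition(1)[OF S h(1) False] ij h(2) by auto
  qed
qed

section \<open>The average number of agreements\<close>

lemma sum_card_double_counting:
  assumes "finite A" "finite B"
  shows "(\<Sum>x\<in>A. card {y \<in> B. R x y}) = (\<Sum>y\<in>B. card {x \<in> A. R x y})"
proof -
  have "(\<Sum>x\<in>A. card {y \<in> B. R x y}) = (\<Sum>x\<in>A. \<Sum>y\<in>B. if R x y then 1 else 0)"
    using assms by (simp add: sum.If_cases Int_def)
  also have "\<dots> = (\<Sum>y\<in>B. \<Sum>x\<in>A. if R x y then 1 else 0)"
    by (rule sum.swap)
  also have "\<dots> = (\<Sum>y\<in>B. card {x \<in> A. R x y})"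
    using assms by (simp add: sum.If_cases Int_def)
  finally show ?thesis .
qed

lemma card_even_perms_translate:
  assumes S: "finite S" and g: "g \<in> even_perms S"
  shows "card {h \<in> even_perms S. P (h \<circ> g)} = card {h \<in> even_perms S. P h}"
proof -
  have cancel: "h \<circ> g \<circ> inv' g = h" "h \<circ> inv' g \<circ> g = h" for h
    using permutes_inv_o[OF even_permsD(1)[OF g]] by (simp_all add: comp_assoc)
  have "bij_betw (\<lambda>h. h \<circ> g) {h \<in> even_perms S. P (h \<circ> g)} {h \<in> even_perms S. P h}"
    by (rule bij_betw_byWitness[where f' = "\<lambda>h. h \<circ> inv' g"])
      (use even_perms_comp[OF S _ g] even_perms_comp[OF S _ even_perms_inv[OF S g]]
        in \<open>auto simp: cancel\<close>)
  then show ?thesis by (rule bij_betw_same_card)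
qed

text \<open>By double transitivity the number of even \<open>h\<close> with \<open>h y = b (h x)\<close> takes only two values,
  \<open>d\<close> when \<open>x = y\<close> and \<open>r\<close> when \<open>x \<noteq> y\<close>. Both are found by summing over all points: over \<open>x\<close>
  along the diagonal for \<open>d\<close>, and over \<open>y\<close> for \<open>r\<close>, because \<open>h y = b (h x)\<close> holds for
  exactly one \<open>y\<close>.\<close>

lemma constant_agreements_value:
  assumes S: "finite S" "card S \<ge> 4" and a: "a permutes S" and b: "b permutes S"
    and const: "\<And>h. h \<in> even_perms S \<Longrightarrow> agreements S a b h = c"
  shows "(int (card S) - 1) * int c =
    (int (card S) - 1)
      + (int (card (fixed_points S a)) - 1) * (int (card (fixed_points S b)) - 1)"
proof -
  let ?E = "even_perms S"
  define N where "N x y = card {h \<in> ?E. h y = b (h x)}" for x y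
  have finE: "finite ?E" using S(1) by (rule finite_even_perms)
  have "id \<in> ?E" by (simp add: even_perms_def permutes_id)
  then have Epos: "card ?E > 0" using finE card_gt_0_iff by blast
  have N_translate: "N (g x) (g y) = N x y" if g: "g \<in> ?E" for g x y
    using card_even_perms_translate[OF S(1) g, of "\<lambda>h. h y = b (h x)"] by (simp add: N_def)
  obtain x0 y0 where xy0: "x0 \<in> S" "y0 \<in> S" "x0 \<noteq> y0"
    using two_distinct_elements[of S] S by auto
  define r where "r = N x0 y0"
  define d where "d = N x0 x0"
  have N_distinct: "N x y = r" if xy: "x \<in> S" "y \<in> S" "x \<noteq> y" for x y
  proof -
    obtain g where g: "g \<in> ?E" "map g [x0, y0] = [x, y]"
      using even_permutation_mapping_lists[OF S(1), of "[x0, y0]" "[x, y]"] xy xy0 S(2) by auto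
    then show ?thesis using N_translate[OF g(1), of x0 y0] by (simp add: r_def)
  qed
  have N_equal: "N x x = d" if x: "x \<in> S" for x
  proof -
    obtain g where g: "g \<in> ?E" "map g [x0] = [x]"
      using even_permutation_mapping_lists[OF S(1), of "[x0]" "[x]"] x xy0 S(2) by auto
    then show ?thesis using N_translate[OF g(1), of x0 x0] by (simp add: d_def)
  qed
  have loop_value: "card S * d = card ?E * card (fixed_points S b)"
  proof -
    have fix_card: "card {x \<in> S. h x = b (h x)} = card (fixed_points S b)" if h: "h \<in> ?E" for h
    proof -
      have hS: "h permutes S" using h by (rule even_permsD)
      have "h ` {x \<in> S. h x = b (h x)} = fixed_points S b"
        using permutes_image[OF hS] by (auto simp: fixed_points_def image_iff set_eq_iff) metis
      then show ?thesis
        using card_image[OF permutes_inj_on[OF hS], of "{x \<in> S. h x = b (h x)}"] by simp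
    qed
    have "card S * d = (\<Sum>x\<in>S. N x x)" using N_equal by simp
    also have "\<dots> = (\<Sum>h\<in>?E. card {x \<in> S. h x = b (h x)})"
      unfolding N_def by (rule sum_card_double_counting[OF S(1) finE])
    also have "\<dots> = card ?E * card (fixed_points S b)" using fix_card by simp
    finally show ?thesis .
  qed
  have arc_value: "d + (card S - 1) * r = card ?E"
  proof -
    have one: "card {y \<in> S. h y = b (h x0)} = 1" if h: "h \<in> ?E" for h
    proof -
      have hS: "h permutes S" using h by (rule even_permsD)
      have bS: "b (h x0) \<in> S" using xy0(1) permutes_in_image[OF hS] permutes_in_image[OF b] by simp
      have "{y \<in> S. h y = b (h x0)} = {inv' h (b (h x0))}"
        using permutes_inv_eq[OF hS] bS permutes_in_image[OF permutes_inv[OF hS]]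
        by (auto simp: eq_commute[of _ "inv' h _"])
      then show ?thesis by simp
    qed
    have "(\<Sum>y\<in>S - {x0}. N x0 y) = (\<Sum>y\<in>S - {x0}. r)"
      by (rule sum.cong[OF refl N_distinct]) (use xy0(1) in auto)
    then have "d + (card S - 1) * r = N x0 x0 + (\<Sum>y\<in>S - {x0}. N x0 y)"
      using xy0(1) S(1) by (simp add: d_def)
    also have "\<dots> = (\<Sum>y\<in>S. N x0 y)" using S(1) xy0(1) by (simp add: sum.remove)
    also have "\<dots> = (\<Sum>h\<in>?E. card {y \<in> S. h y = b (h x0)})"
      unfolding N_def by (rule sum_card_double_counting[OF S(1) finE])
    also have "\<dots> = card ?E" using one by simp
    finally show ?thesis .
  qed
  let ?F = "fixed_points S a"
  have Fsub: "?F \<subseteq> S" by (auto simp: fixed_points_def)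
  have total: "card ?E * c = card ?F * d + (card S - card ?F) * r"
  proof -
    have "card ?E * c = (\<Sum>h\<in>?E. card {x \<in> S. h (a x) = b (h x)})"
      using const by (simp add: agreements_def)
    also have "\<dots> = (\<Sum>x\<in>S. N x (a x))"
      unfolding N_def by (rule sum_card_double_counting[OF finE S(1)])
    also have "\<dots> = (\<Sum>x\<in>S - ?F. N x (a x)) + (\<Sum>x\<in>?F. N x (a x))"
      by (rule sum.subset_diff[OF Fsub S(1)])
    also have "(\<Sum>x\<in>?F. N x (a x)) = card ?F * d"
      using N_equal by (simp add: fixed_points_def)
    also have "(\<Sum>x\<in>S - ?F. N x (a x)) = (\<Sum>x\<in>S - ?F. r)"
      by (rule sum.cong[OF refl N_distinct])
        (use permutes_in_image[OF a] in \<open>auto simp: fixed_points_def\<close>)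
    also have "\<dots> = (card S - card ?F) * r"
      using Fsub S(1) by (simp add: card_Diff_subset finite_subset)
    finally show ?thesis by simp
  qed
  define n where "n = int (card S)"
  define e where "e = int (card ?E)"
  define fa where "fa = int (card ?F)"
  define fb where "fb = int (card (fixed_points S b))"
  have fa_le: "card ?F \<le> card S" using Fsub S(1) by (rule card_mono[rotated])
  have i1: "n * int d = e * fb"
    using arg_cong[OF loop_value, of int] by (simp add: n_def e_def fb_def)
  have i2: "int d + (n - 1) * int r = e"
    using arg_cong[OF arc_value, of int] S(2) by (simp add: n_def e_def of_nat_diff)
  have i3: "e * int c = fa * int d + (n - fa) * int r"
    using arg_cong[OF total, of int] fa_le by (simp add: n_def e_def fa_def of_nat_diff)
  \<comment> \<open>The factor \<open>n (n - 1)\<close> turns \<open>d\<close> and \<open>r\<close> into the multiples that \<open>i1\<close> and \<open>i2\<close> determine.\<close>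
  have "e * n * ((n - 1) * int c) = n * (n - 1) * (e * int c)"
    by (simp add: algebra_simps)
  also have "\<dots> = (n - 1) * fa * (n * int d) + n * (n - fa) * ((n - 1) * int r)"
    unfolding i3 by (simp add: algebra_simps)
  also have "(n - 1) * int r = e - int d" using i2 by simp
  also have "(n - 1) * fa * (n * int d) + n * (n - fa) * (e - int d)
      = (n - 1) * fa * (n * int d) + (n - fa) * (n * e - n * int d)"
    by (simp add: algebra_simps)
  also have "\<dots> = e * n * ((n - 1) + (fa - 1) * (fb - 1))"
    unfolding i1 by (simp add: algebra_simps)
  finally have "(n - 1) * int c = (n - 1) + (fa - 1) * (fb - 1)"
    using Epos S(2) by (simp add: e_def n_def)
  then show ?thesis by (simp add: n_def fa_def fb_def)
qed

section \<open>Even permutations with many agreements\<close>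

lemma permutes_in_moved:
  assumes a: "a permutes S" and x: "x \<in> S" "a x \<noteq> x"
  shows "a x \<in> S" "a (a x) \<noteq> a x"
  using permutes_in_image[OF a] x permutes_inj[OF a] by (auto dest: injD)

text \<open>Besides one arc \<open>x \<rightarrow> a x\<close>, only the inclusion of the moved points of \<open>a\<close> into those of \<open>b\<close>
  has to be kept when the sign of \<open>h\<close> is corrected. So a transposition of two further moved points
  of \<open>a\<close> does as well as one of two fixed points, and with at least three points besides \<open>x\<close> and
  \<open>a x\<close> one of the two is available.\<close>

lemma agreements_above_fixed_points:
  assumes S: "finite S" "card S \<ge> 5" and a: "a permutes S" "a \<noteq> id" and b: "b permutes S" "b \<noteq> id"
    and le: "card (fixed_points S b) \<le> card (fixed_points S a)"
  obtains h where "h \<in> even_perms S" "agreements S a b h \<ge> card (fixed_points S b) + 1"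
proof -
  define A where "A = S - fixed_points S a"
  define B where "B = S - fixed_points S b"
  have AS: "A \<subseteq> S" and BS: "B \<subseteq> S" by (auto simp: A_def B_def)
  have moved_A: "x \<in> A \<longleftrightarrow> x \<in> S \<and> a x \<noteq> x" and moved_B: "x \<in> B \<longleftrightarrow> x \<in> S \<and> b x \<noteq> x" for x
    by (auto simp: A_def B_def fixed_points_def)
  have finA: "finite A" and finB: "finite B" using AS BS S(1) finite_subset by auto
  have fixS: "fixed_points S a \<subseteq> S" "fixed_points S b \<subseteq> S"
    by (auto simp: fixed_points_def)
  have cardAB: "card A \<le> card B"
    using le S(1) fixS by (simp add: A_def B_def card_Diff_subset finite_subset)
  obtain x where x: "x \<in> S" "a x \<noteq> x"
    using a permutes_not_in by (metis eq_id_iff)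
  obtain u where u: "u \<in> S" "b u \<noteq> u"
    using b permutes_not_in by (metis eq_id_iff)
  have xA: "x \<in> A" "a x \<in> A" and uB: "u \<in> B" "b u \<in> B"
    using x u permutes_in_moved[OF a(1) x] permutes_in_moved[OF b(1) u]
    by (auto simp: moved_A moved_B)
  have "card (A - {x, a x}) \<le> card (B - {u, b u})"
    using cardAB xA uB x u finA finB by (simp add: card_Diff_subset)
  then obtain f where f: "f ` (A - {x, a x}) \<subseteq> B - {u, b u}" "inj_on f (A - {x, a x})"
    using card_le_inj[of "A - {x, a x}" "B - {u, b u}"] finA finB by auto
  define f' where "f' = f(x := u, a x := b u)"
  have f'B: "f' ` A \<subseteq> B" using f(1) uB by (auto simp: f'_def)
  have "inj_on f' A"
  proof (rule inj_onI)
    fix y z assume yz: "y \<in> A" "z \<in> A" "f' y = f' z"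
    have f_new: "f w \<noteq> u \<and> f w \<noteq> b u" if "w \<in> A" "w \<noteq> x" "w \<noteq> a x" for w
      using that f(1) by blast
    show "y = z"
      using yz f_new[of y] f_new[of z] x u inj_onD[OF f(2), of y z]
      by (auto simp: f'_def split: if_splits)
  qed
  then have "bij_betw f' A (f' ` A)" by (simp add: bij_betw_def)
  then obtain h where h: "h permutes S" "\<And>y. y \<in> A \<Longrightarrow> h y = f' y"
    using bij_betw_extends_to_permutation[OF S(1) AS, of "f' ` A" f'] f'B BS by blast
  have good_h: "h ` A \<subseteq> B" "h x = u" "h (a x) = b u"
    using h(2) f'B xA x by (auto simp: f'_def)
  obtain k where k: "k \<in> even_perms S" "k ` A \<subseteq> B" "k x = u" "k (a x) = b u"
  proof (cases "evenperm h")
    case True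
    then show thesis using that[of h] h(1) good_h by (auto simp: even_perms_def)
  next
    case False
    have "card A + card (S - A) = card S"
      using AS S(1) by (simp add: card_Diff_subset finA card_mono)
    then have "card (A - {x, a x}) \<ge> 2 \<or> card (S - A) \<ge> 2"
      using S(2) xA x finA by (simp add: card_Diff_subset) linarith
    then obtain i j where ij: "i \<noteq> j"
      "i \<in> A - {x, a x} \<and> j \<in> A - {x, a x} \<or> i \<in> S - A \<and> j \<in> S - A"
      using two_distinct_elements by metis
    then have "h \<circ> transpose i j \<in> even_perms S"
      using even_after_transposition(1)[OF S(1) h(1) False] AS by auto
    moreover have "transpose i j ` A \<subseteq> A"
      using ij by (auto simp: transpose_def)
    then have "(h \<circ> transpose i j) ` A \<subseteq> B" using good_h(1) by fastforce
    moreover have "transpose i j x = x" "transpose i j (a x) = a x"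
      using ij xA by (auto simp: transpose_def)
    ultimately show thesis using that[of "h \<circ> transpose i j"] good_h by simp
  qed
  have kS: "k permutes S" using k(1) by (rule even_permsD)
  let ?K = "inv' k ` fixed_points S b"
  have "insert x ?K \<subseteq> {y \<in> S. k (a y) = b (k y)}"
  proof (intro insert_subsetI image_subsetI)
    show "x \<in> {y \<in> S. k (a y) = b (k y)}" using x k by simp
  next
    fix v assume v: "v \<in> fixed_points S b"
    let ?y = "inv' k v"
    have ky: "k ?y = v" using permutes_inverses(1)[OF kS] .
    have yS: "?y \<in> S"
      using v permutes_in_image[OF permutes_inv[OF kS]] by (simp add: fixed_points_def)
    have "?y \<notin> A"
      using v k(2) ky by (auto simp: B_def)
    then have "a ?y = ?y" using yS by (simp add: moved_A)
    then show "?y \<in> {y \<in> S. k (a y) = b (k y)}"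
      using yS ky v by (simp add: fixed_points_def)
  qed
  then have "card (insert x ?K) \<le> agreements S a b k"
    unfolding agreements_def using S(1) by (intro card_mono) auto
  moreover have "x \<notin> ?K"
  proof
    assume "x \<in> ?K"
    then obtain v where "v \<in> fixed_points S b" "x = inv' k v" by blast
    then have "u \<in> fixed_points S b" using k(3) permutes_inverses(1)[OF kS, of v] by simp
    then show False using u by (simp add: fixed_points_def)
  qed
  moreover have "card ?K = card (fixed_points S b)"
    by (rule card_image) (rule permutes_inj_on[OF permutes_inv[OF kS]])
  ultimately have "agreements S a b k \<ge> card (fixed_points S b) + 1"
    using S(1) fixS(2) finite_subset by fastforce
  with k(1) show thesis by (rule that)
qed

lemma two_disjoint_arcs:
  assumes S: "finite S" "card S \<ge> 5" and a: "a permutes S" and few: "card (fixed_points S a) \<le> 1"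
  obtains x s where "x \<in> S" "s \<in> S" "distinct [x, a x, s, a s]"
proof -
  have "card (S - fixed_points S a) \<ge> 4"
    using S few by (simp add: card_Diff_subset fixed_points_def)
  then have "S - fixed_points S a \<noteq> {}" by (metis card.empty not_numeral_le_zero)
  then obtain x where x: "x \<in> S" "a x \<noteq> x"
    by (auto simp: fixed_points_def)
  \<comment> \<open>The start of the second arc avoids the first arc and the predecessor of \<open>x\<close>; its end then
    avoids the first arc too, by injectivity.\<close>
  let ?X = "fixed_points S a \<union> {x, a x, inv' a x}"
  have "finite ?X" using S(1) by (simp add: fixed_points_def)
  have "card ?X \<le> card (fixed_points S a) + card {x, a x, inv' a x}" by (rule card_Un_le)
  also have "\<dots> \<le> 1 + 3"
    using few by (intro add_mono) (auto simp: card_insert_if)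
  finally have "card ?X < card S" using S(2) by simp
  then obtain s where s: "s \<in> S" "s \<notin> ?X"
    using card_mono[OF \<open>finite ?X\<close>, of S] by (metis not_le subsetI)
  have "a s \<noteq> x" using s permutes_inverses(2)[OF a, of s] by auto
  moreover have "a s \<noteq> a x" using s permutes_inj[OF a] by (auto dest: injD)
  moreover have "a s \<noteq> s" using s by (simp add: fixed_points_def)
  ultimately have "distinct [x, a x, s, a s]" using x s by auto
  with x(1) s(1) show thesis by (rule that)
qed

text \<open>Two arcs take up at most four points, which is too many for the transitivity of the
  alternating group of degree 5. If neither permutation is an involution, two consecutive arcs
  can be used, and they take up only three. If one of them is an involution, then it commutes with
  the transposition that exchanges the ends of an arc. Composition with this transposition changes
  the sign of \<open>h\<close> without changing the number of agreements.\<close>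

lemma two_agreements:
  assumes S: "finite S" "card S \<ge> 5" and a: "a permutes S" and b: "b permutes S"
    and fa: "card (fixed_points S a) \<le> 1" and fb: "card (fixed_points S b) \<le> 1"
  obtains h where "h \<in> even_perms S" "agreements S a b h \<ge> 2"
proof -
  have aS: "a x \<in> S" if "x \<in> S" for x using that permutes_in_image[OF a] by simp
  have bS: "b x \<in> S" if "x \<in> S" for x using that permutes_in_image[OF b] by simp
  have enough: "agreements S a b h \<ge> 2"
    if "y \<in> S" "z \<in> S" "y \<noteq> z" "h (a y) = b (h y)" "h (a z) = b (h z)" for h y z
  proof -
    have "card {y, z} \<le> agreements S a b h"
      unfolding agreements_def using S(1) that by (intro card_mono) auto
    then show ?thesis using that(3) by simp
  qed
  show thesis
  proof (cases "(\<forall>y\<in>S. a (a y) = y) \<or> (\<forall>v\<in>S. b (b v) = v)")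
    case False
    then obtain x u where x: "x \<in> S" "a (a x) \<noteq> x" and u: "u \<in> S" "b (b u) \<noteq> u" by blast
    have "a x \<noteq> x" "b u \<noteq> u" using x u by auto
    then have "distinct [x, a x, a (a x)]" "distinct [u, b u, b (b u)]"
      using x u permutes_in_moved(2)[OF a x(1), symmetric] permutes_in_moved(2)[OF b u(1), symmetric]
      by auto
    then obtain h where "h \<in> even_perms S" "map h [x, a x, a (a x)] = [u, b u, b (b u)]"
      using even_permutation_mapping_lists[OF S(1), of "[x, a x, a (a x)]" "[u, b u, b (b u)]"]
        x u S(2) aS bS by auto
    moreover have "x \<noteq> a x" using x by auto
    ultimately show thesis
      using enough[of x "a x" h] x aS by (intro that[of h]) auto
  next
    case involution: True
    obtain x s where xs: "x \<in> S" "s \<in> S" "distinct [x, a x, s, a s]"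
      using two_disjoint_arcs[OF S a fa] .
    obtain u t where ut: "u \<in> S" "t \<in> S" "distinct [u, b u, t, b t]"
      using two_disjoint_arcs[OF S b fb] .
    obtain h where h: "h permutes S" "map h [x, a x, s, a s] = [u, b u, t, b t]"
      using permutation_mapping_lists[OF S(1), of "[x, a x, s, a s]" "[u, b u, t, b t]"]
        xs ut aS bS by auto
    show thesis
    proof (cases "evenperm h")
      case True
      then have "h \<in> even_perms S" using h(1) by (simp add: even_perms_def)
      then show thesis
        using enough[of x s h] xs h(2) by (intro that[of h]) auto
    next
      case odd: False
      from involution show thesis
      proof
        assume invol: "\<forall>y\<in>S. a (a y) = y"
        let ?k = "h \<circ> transpose x (a x)"
        have "?k \<in> even_perms S"
          using even_after_transposition(1)[OF S(1) h(1) odd] xs aS by auto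
        moreover have "agreements S a b ?k \<ge> 2"
          by (rule enough[of "a x" s]) (use xs h(2) aS invol in \<open>auto simp: transpose_def\<close>)
        ultimately show thesis by (rule that)
      next
        assume invol: "\<forall>v\<in>S. b (b v) = v"
        let ?k = "transpose u (b u) \<circ> h"
        have "?k \<in> even_perms S"
          using even_after_transposition(2)[OF S(1) h(1) odd] ut bS by auto
        moreover have "agreements S a b ?k \<ge> 2"
          by (rule enough[of x s]) (use xs ut h(2) invol in \<open>auto simp: transpose_def\<close>)
        ultimately show thesis by (rule that)
      qed
    qed
  qed
qed

section \<open>Fixed points on products of conjugacy classes\<close>

lemma constant_agreements_impossible:
  assumes S: "finite S" "card S \<ge> 5" and a: "a permutes S" "a \<noteq> id" and b: "b permutes S" "b \<noteq> id"
    and le: "card (fixed_points S b) \<le> card (fixed_points S a)"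
    and const: "\<And>h. h \<in> even_perms S \<Longrightarrow> agreements S a b h = c"
  shows False
proof -
  define n where "n = int (card S)"
  define p where "p = int (card (fixed_points S a))"
  define q where "q = int (card (fixed_points S b))"
  have c_value: "(n - 1) * int c = (n - 1) + (p - 1) * (q - 1)"
    using constant_agreements_value[OF S(1) _ a(1) b(1) const] S(2)
    by (simp add: n_def p_def q_def)
  have n: "n \<ge> 5" using S(2) by (simp add: n_def)
  have "fixed_points S a \<subset> S"
  proof -
    obtain x where "a x \<noteq> x" using a(2) by (metis eq_id_iff)
    then show ?thesis using permutes_not_in[OF a(1)] by (auto simp: fixed_points_def)
  qed
  then have p: "0 \<le> p" "p < n" using psubset_card_mono[OF S(1)] by (auto simp: n_def p_def)
  have q: "0 \<le> q" "q \<le> p" using le by (auto simp: p_def q_def)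
  obtain h where "h \<in> even_perms S" "agreements S a b h \<ge> card (fixed_points S b) + 1"
    using agreements_above_fixed_points[OF S a b le] .
  then have c: "int c \<ge> q + 1" using const by (auto simp: q_def)
  show False
  proof (cases "q = 0")
    case False
    then have "(p - 1) * (q - 1) \<le> (n - 1) * (q - 1)"
      using p q by (intro mult_right_mono) auto
    moreover have "(n - 1) * (q + 1) \<le> (n - 1) * int c"
      using c n by (intro mult_left_mono) auto
    ultimately show False using c_value n by (simp add: algebra_simps)
  next
    case q0: True
    then have eq: "(n - 1) * int c = n - p" using c_value by (simp add: algebra_simps)
    have c1: "c = 1"
    proof (rule ccontr)
      assume "c \<noteq> 1"
      then have "int c \<ge> 2" using c q0 by simp
      then have "(n - 1) * 2 \<le> (n - 1) * int c" using n by (intro mult_left_mono) auto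
      then show False using eq p n by simp
    qed
    then have "p = 1" using eq by simp
    then obtain k where "k \<in> even_perms S" "agreements S a b k \<ge> 2"
      using two_agreements[OF S a(1) b(1)] q0 by (auto simp: p_def q_def)
    then show False using const c1 by fastforce
  qed
qed

lemma agreements_not_constant:
  assumes S: "finite S" "card S \<ge> 5" and a: "a permutes S" "a \<noteq> id" and b: "b permutes S" "b \<noteq> id"
  shows "\<not> (\<exists>c. \<forall>h \<in> even_perms S. agreements S a b h = c)"
proof
  assume "\<exists>c. \<forall>h \<in> even_perms S. agreements S a b h = c"
  then obtain c where c: "\<And>h. h \<in> even_perms S \<Longrightarrow> agreements S a b h = c" by blast
  have c': "agreements S b a h = c" if h: "h \<in> even_perms S" for h
    using agreements_commute[OF even_permsD(1)[OF h], of a b] c[OF even_perms_inv[OF S(1) h]]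
      agreements_commute[OF even_permsD(1)[OF even_perms_inv[OF S(1) h]], of b a]
      permutes_inv_inv[OF even_permsD(1)[OF h]] by simp
  show False
  proof (cases "card (fixed_points S b) \<le> card (fixed_points S a)")
    case True
    then show False using constant_agreements_impossible[OF S a b _ c] by blast
  next
    case False
    then show False using constant_agreements_impossible[OF S b a _ c'] by simp
  qed
qed

lemma num_fixed_points_conj_comp:
  assumes h: "h permutes {1..n}" and b: "b permutes {1..n}"
  shows "num_fixed_points n (inv' h \<circ> a \<circ> h \<circ> b) = agreements {1..n} (inv' b) a h"
proof -
  have inv_eq: "inv' h v = i \<longleftrightarrow> h i = v" for v i
    using permutes_inverses[OF h] by metis
  have "b ` {i \<in> {1..n}. (inv' h \<circ> a \<circ> h \<circ> b) i = i} = {y \<in> {1..n}. h (inv' b y) = a (h y)}"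
  proof (intro equalityI subsetI)
    fix y assume "y \<in> b ` {i \<in> {1..n}. (inv' h \<circ> a \<circ> h \<circ> b) i = i}"
    then show "y \<in> {y \<in> {1..n}. h (inv' b y) = a (h y)}"
      using permutes_in_image[OF b] permutes_inverses(2)[OF b] by (auto simp: inv_eq)
  next
    fix y assume y: "y \<in> {y \<in> {1..n}. h (inv' b y) = a (h y)}"
    have "y = b (inv' b y)" using permutes_inverses(1)[OF b] by simp
    then show "y \<in> b ` {i \<in> {1..n}. (inv' h \<circ> a \<circ> h \<circ> b) i = i}"
      using y permutes_in_image[OF permutes_inv[OF b], of y]
      by (intro image_eqI[of _ _ "inv' b y"]) (auto simp: inv_eq)
  qed
  then show ?thesis
    unfolding num_fixed_points_def agreements_def
    using card_image[OF permutes_inj_on[OF b], of "{i \<in> {1..n}. (inv' h \<circ> a \<circ> h \<circ> b) i = i}"]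
    by simp
qed

theorem theorem1p4:
  fixes n :: nat and a b :: "nat \<Rightarrow> nat"
  assumes "n \<ge> 5"
    and "a \<in> carrier (sym_group n)" and "a \<noteq> \<one>\<^bsub>sym_group n\<^esub>"
    and "b \<in> carrier (sym_group n)" and "b \<noteq> \<one>\<^bsub>sym_group n\<^esub>"
  shows "\<not> (\<exists>c. \<forall>g \<in> conj_orbit (sym_group n) a (carrier (alt_group n))
                  <#>\<^bsub>sym_group n\<^esub> conj_orbit (sym_group n) b (carrier (alt_group n)).
              num_fixed_points n g = c)"
proof
  let ?G = "sym_group n" and ?H = "carrier (alt_group n)"
  assume "\<exists>c. \<forall>g \<in> conj_orbit ?G a ?H <#>\<^bsub>?G\<^esub> conj_orbit ?G b ?H. num_fixed_points n g = c"
  then obtain c where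
    c: "\<And>g. g \<in> conj_orbit ?G a ?H <#>\<^bsub>?G\<^esub> conj_orbit ?G b ?H \<Longrightarrow> num_fixed_points n g = c"
    by blast
  have a: "a permutes {1..n}" "a \<noteq> id" and b: "b permutes {1..n}" "b \<noteq> id"
    using assms by (auto simp: sym_group_carrier sym_group_one)
  have "inv' b \<noteq> id" using b permutes_inv_inv[OF b(1)] by (metis inv_id)
  moreover have "agreements {1..n} (inv' b) a h = c" if h: "h \<in> even_perms {1..n}" for h
  proof -
    have hS: "h permutes {1..n}" using h by (rule even_permsD)
    have hH: "h \<in> ?H" and idH: "id \<in> ?H"
      using h by (auto simp: alt_group_carrier even_perms_def permutes_id)
    have "inv' h \<circ> a \<circ> h \<in> conj_orbit ?G a ?H"
      unfolding conj_orbit_def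
      by (rule CollectI, rule exI[of _ h])
        (use hH hS in \<open>simp add: sym_group_mult sym_group_carrier\<close>)
    moreover have "b \<in> conj_orbit ?G b ?H"
      unfolding conj_orbit_def
      by (rule CollectI, rule exI[of _ id])
        (use idH in \<open>simp add: sym_group_mult sym_group_carrier permutes_id\<close>)
    ultimately have "inv' h \<circ> a \<circ> h \<circ> b \<in> conj_orbit ?G a ?H <#>\<^bsub>?G\<^esub> conj_orbit ?G b ?H"
      by (auto simp: set_mult_def sym_group_mult)
    then have "num_fixed_points n (inv' h \<circ> a \<circ> h \<circ> b) = c" by (rule c)
    then show ?thesis unfolding num_fixed_points_conj_comp[OF hS b(1)] .
  qed
  ultimately show False
    using agreements_not_constant[of "{1..n}" "inv' b" a] assms(1) a permutes_inv[OF b(1)] by auto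
qed

end
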